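(* Let $A$ be a real symmetric $n\times n$ matrix that is a Robinson similarity matrix, and let $\Delta\in[n-1]$. Then, for any permutation $\pi$ of $[n]$, $$\langle A_\pi,B^\Delta_n\rangle\ \ge\ \langle A,B^\Delta_n\rangle .$$
   Context: $[m]=\{1,\ldots,m\}$. A real symmetric $n\times n$ matrix $A$ is a Robinson similarity matrix if $A_{ik}\le \min\{A_{ij},A_{jk}\}$ for all $1\le i\le j\le k\le n$. For a permutation $\pi$ of $[n]$, $A_\pi=(A_{\pi(i)\pi(j)})_{i,j=1}^n$. For real $n\times n$ matrices $A,B$, $\langle A,B\rangle=\sum_{i,j=1}^n A_{ij}B_{ij}$. For an integer $\Delta\in[n]$, $B^\Delta_n$ is the symmetric $n\times n$ matrix with $(i,j)$-entry equal to $1$ if $|i-j|\ge n-\Delta$ and $0$ otherwise. *)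

theory Defs
  imports "Jordan_Normal_Form.Matrix" "HOL-Combinatorics.Permutations"
begin

text \<open>
  Matrices have row and column indices \<open>0, \<dots>, n - 1\<close>, so \<open>i \<in> [n]\<close> is rendered as the
  index \<open>i - 1\<close>. The conditions below use only the order and differences of indices, and so are
  unaffected by the shift.
\<close>

definition robinson_similarity :: "nat \<Rightarrow> real mat \<Rightarrow> bool" where
  "robinson_similarity n A \<longleftrightarrow>
     A \<in> carrier_mat n n \<and> transpose_mat A = A \<and>
     (\<forall>i j k. i \<le> j \<and> j \<le> k \<and> k < n \<longrightarrow> A $$ (i, k) \<le> min (A $$ (i, j)) (A $$ (j, k)))"

definition permute_mat :: "nat \<Rightarrow> (nat \<Rightarrow> nat) \<Rightarrow> real mat \<Rightarrow> real mat" where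
  "permute_mat n \<pi> A = mat n n (\<lambda>(i, j). A $$ (\<pi> i, \<pi> j))"

definition mat_inner :: "nat \<Rightarrow> real mat \<Rightarrow> real mat \<Rightarrow> real" where
  "mat_inner n A B = (\<Sum>i<n. \<Sum>j<n. A $$ (i, j) * B $$ (i, j))"

definition corner_mat :: "nat \<Rightarrow> nat \<Rightarrow> real mat" where
  "corner_mat n \<Delta> =
     mat n n (\<lambda>(i, j). if \<bar>int i - int j\<bar> \<ge> int n - int \<Delta> then 1 else 0)"

end

theory Submission
  imports Defs
begin

text \<open>
  Write \<open>m = n - \<Delta> \<ge> 1\<close>. Both matrices being symmetric, the inner product is twice the sum of the
  entries at the positions \<open>(i, j)\<close> with \<open>i + m \<le> j\<close>; call this the corner sum. The
  theorem is proved for corner sums, for all \<open>n\<close> and fixed \<open>m\<close>, by induction on \<open>n\<close>.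

  Let \<open>v\<close> be the index that \<open>\<pi>\<close> puts at the last position. In the permuted corner sum, the last
  position contributes the entries \<open>A u v\<close> for \<open>u\<close> in some set \<open>U\<close> of \<open>\<Delta>\<close> indices other
  than \<open>v\<close>, and the remaining positions form a permuted corner sum of the matrix \<open>A'\<close> that
  arises from \<open>A\<close> by deleting row and column \<open>v\<close>. This \<open>A'\<close> is again Robinson, so by induction
  the theorem follows once the corner sum of \<open>A\<close> exceeds that of \<open>A'\<close> by at most the contribution
  of \<open>U\<close>.

  That excess is explicit. Closing the gap at \<open>v\<close> loses the corner entries in row or column \<open>v\<close>,
  and also the entries \<open>(c, c + m)\<close> with \<open>c < v < c + m\<close>, which move too close to the
  diagonal. There are exactly \<open>\<Delta>\<close> lost entries, one for each \<open>c < \<Delta>\<close> (\<open>corner_sum_delete\<close>).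
  On the other side, the entries of column \<open>v\<close> of a Robinson matrix decrease away from the
  diagonal, so \<open>U\<close>, with \<open>p\<close> elements below \<open>v\<close> and \<open>\<Delta> - p\<close> elements above it,
  contributes at least as much as the \<open>p\<close> smallest and the \<open>\<Delta> - p\<close> largest indices. These can
  be paired with the lost entries so that each lost entry is the smaller one, again by the Robinson
  property (\<open>deleted_entries_le\<close>).
\<close>

section \<open>Corner sums\<close>

definition corner_sum :: "nat \<Rightarrow> nat \<Rightarrow> (nat \<Rightarrow> nat \<Rightarrow> real) \<Rightarrow> real" where
  "corner_sum m n f = (\<Sum>j<n. \<Sum>i<Suc j - m. f i j)"

lemma corner_sum_Suc:
  "corner_sum m (Suc n) f = corner_sum m n f + (\<Sum>i<Suc n - m. f i n)"
  by (simp add: corner_sum_def)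

lemma corner_sum_cong:
  assumes "\<And>i j. i < n \<Longrightarrow> j < n \<Longrightarrow> f i j = g i j" and "m \<ge> 1"
  shows "corner_sum m n f = corner_sum m n g"
  unfolding corner_sum_def using assms by (intro sum.cong) auto

lemma sum_abs_diff_ge_eq_corner_sum:
  fixes f :: "nat \<Rightarrow> nat \<Rightarrow> real"
  assumes "m \<ge> 1" and "\<And>i j. i < n \<Longrightarrow> j < n \<Longrightarrow> f i j = f j i"
  shows "(\<Sum>i<n. \<Sum>j<n. if \<bar>int i - int j\<bar> \<ge> int m then f i j else 0) = 2 * corner_sum m n f"
  using assms(2)
proof (induction n)
  case 0
  then show ?case by (simp add: corner_sum_def)
next
  case (Suc n)
  let ?F = "\<lambda>i j. if \<bar>int i - int j\<bar> \<ge> int m then f i j else 0"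
  have col: "(\<Sum>i<n. ?F i n) = (\<Sum>i<Suc n - m. f i n)"
  proof -
    have "(\<Sum>i<n. ?F i n) = (\<Sum>i<n. if i \<in> {..<Suc n - m} then f i n else 0)"
      by (intro sum.cong) auto
    also have "\<dots> = (\<Sum>i\<in>{..<n} \<inter> {..<Suc n - m}. f i n)"
      by (simp add: sum.inter_restrict)
    also have "{..<n} \<inter> {..<Suc n - m} = {..<Suc n - m}"
      using assms(1) by auto
    finally show ?thesis .
  qed
  have row: "(\<Sum>j<n. ?F n j) = (\<Sum>i<n. ?F i n)"
    using Suc.prems by (intro sum.cong) (auto simp: abs_minus_commute)
  have diag: "?F n n = 0"
    using assms(1) by simp
  have "(\<Sum>i<Suc n. \<Sum>j<Suc n. ?F i j)
      = (\<Sum>i<n. \<Sum>j<n. ?F i j) + (\<Sum>i<n. ?F i n) + (\<Sum>j<n. ?F n j) + ?F n n"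
    by (simp add: sum.distrib)
  also have "(\<Sum>i<n. \<Sum>j<n. ?F i j) = 2 * corner_sum m n f"
    using Suc.IH Suc.prems by simp
  finally show ?case
    by (simp only: row col diag corner_sum_Suc distrib_left mult_2 ac_simps add_0_right add_0_left)
qed

lemma mat_inner_corner_mat:
  assumes "\<Delta> < n" and "\<And>i j. i < n \<Longrightarrow> j < n \<Longrightarrow> M $$ (i, j) = M $$ (j, i)"
  shows "mat_inner n M (corner_mat n \<Delta>) = 2 * corner_sum (n - \<Delta>) n (\<lambda>i j. M $$ (i, j))"
proof -
  have "mat_inner n M (corner_mat n \<Delta>) =
     (\<Sum>i<n. \<Sum>j<n. if \<bar>int i - int j\<bar> \<ge> int (n - \<Delta>) then M $$ (i, j) else 0)"
    unfolding mat_inner_def corner_mat_def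
    using assms(1) by (intro sum.cong refl) (auto simp: of_nat_diff)
  also have "\<dots> = 2 * corner_sum (n - \<Delta>) n (\<lambda>i j. M $$ (i, j))"
    using assms by (intro sum_abs_diff_ge_eq_corner_sum) auto
  finally show ?thesis .
qed

section \<open>Deleting an index\<close>

definition skip :: "nat \<Rightarrow> nat \<Rightarrow> nat" where
  "skip v i = (if i < v then i else Suc i)"

lemma sum_skip:
  fixes g :: "nat \<Rightarrow> real"
  shows "(\<Sum>i<Suc k. g i) = (\<Sum>i<k. g (skip v i)) + g (min k v)"
proof (induction k)
  case 0
  then show ?case by simp
next
  case (Suc k)
  consider "Suc k \<le> v" | "v \<le> k" by linarith
  then show ?case using Suc.IH by cases (auto simp: skip_def min_absorb1 min_absorb2)
qed

text \<open>
  The corner entries that are lost when index \<open>v\<close> is deleted, indexed by \<open>c < n - m\<close>: for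
  \<open>c + m \<le> v\<close> and for \<open>c \<ge> v\<close> they are the corner entries of column and row \<open>v\<close>; in
  between, they are the entries at distance exactly \<open>m\<close> whose two indices lie on
  different sides of \<open>v\<close>.
\<close>

definition deleted_entry :: "nat \<Rightarrow> (nat \<Rightarrow> nat \<Rightarrow> real) \<Rightarrow> nat \<Rightarrow> nat \<Rightarrow> real" where
  "deleted_entry m a v c = a (min c v) (max (c + m) v)"

text \<open>
  Induction on the number of columns, starting from \<open>v\<close> as the last one. Each later column \<open>k\<close> is
  one entry shorter after the deletion, since it moves one place to the left. The missing entry
  is in row \<open>v\<close> if the column reaches that row, and otherwise it is the lowest entry, at
  distance \<open>m\<close> from the diagonal.
\<close>

lemma corner_sum_delete:
  assumes "m \<ge> 1" and "v \<le> n"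
  shows "corner_sum m (Suc n) a
    = corner_sum m n (\<lambda>i j. a (skip v i) (skip v j)) + (\<Sum>c<Suc n - m. deleted_entry m a v c)"
  using assms(2)
proof (induction n rule: dec_induct)
  case base
  have "corner_sum m v (\<lambda>i j. a (skip v i) (skip v j)) = corner_sum m v a"
    using assms(1) by (intro corner_sum_cong) (auto simp: skip_def)
  moreover have "(\<Sum>c<Suc v - m. deleted_entry m a v c) = (\<Sum>i<Suc v - m. a i v)"
    using assms(1) by (intro sum.cong) (auto simp: deleted_entry_def min_def max_def)
  ultimately show ?case by (simp add: corner_sum_Suc)
next
  case (step k)
  let ?a' = "\<lambda>i j. a (skip v i) (skip v j)"
  have col: "(\<Sum>i<Suc (Suc k) - m. a i (Suc k)) + (\<Sum>c<Suc k - m. deleted_entry m a v c)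
    = (\<Sum>i<Suc k - m. ?a' i k) + (\<Sum>c<Suc (Suc k) - m. deleted_entry m a v c)"
  proof (cases "m \<le> Suc k")
    case True
    define c where "c = Suc k - m"
    have c: "Suc (Suc k) - m = Suc c" "Suc k - m = c" "c + m = Suc k"
      using True by (auto simp: c_def)
    have "deleted_entry m a v c = a (min c v) (Suc k)"
      using step.hyps by (simp add: deleted_entry_def c)
    moreover have "skip v k = Suc k"
      using step.hyps by (simp add: skip_def)
    ultimately show ?thesis
      unfolding c(1,2) sum_skip[of "\<lambda>i. a i (Suc k)" c v] by simp
  next
    case False
    then show ?thesis by simp
  qed
  show ?case
    using step.IH col unfolding corner_sum_Suc[of m "Suc k" a] corner_sum_Suc[of m k ?a']
    by linarith
qed

section \<open>Sums along a column of a Robinson matrix\<close>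

lemma sum_initial_segment_le:
  fixes g :: "nat \<Rightarrow> real"
  assumes "\<And>i j. i \<le> j \<Longrightarrow> j < v \<Longrightarrow> g i \<le> g j" and "P \<subseteq> {..<v}"
  shows "(\<Sum>c<card P. g c) \<le> sum g P"
  using assms(2)
proof (induction "card P" arbitrary: P)
  case 0
  then have "finite P" by (meson finite_lessThan finite_subset)
  with 0 show ?case by simp
next
  case (Suc k)
  have fin: "finite P" using Suc.prems by (meson finite_lessThan finite_subset)
  have ne: "P \<noteq> {}" using Suc.hyps(2) by auto
  define M where "M = Max P"
  have M: "M \<in> P" "\<And>x. x \<in> P \<Longrightarrow> x \<le> M"
    using fin ne by (auto simp: M_def)
  have card: "card (P - {M}) = k" using Suc.hyps(2) M(1) fin by simp
  have "P - {M} \<subseteq> {..<M}" using M(2) by (auto simp: less_le)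
  then have "k \<le> M" using card_mono[of "{..<M}" "P - {M}"] card by simp
  then have "g k \<le> g M" using M(1) Suc.prems assms(1) by auto
  moreover have "(\<Sum>c<k. g c) \<le> sum g (P - {M})"
    using Suc.hyps(1)[of "P - {M}"] card Suc.prems by auto
  moreover have "sum g P = g M + sum g (P - {M})"
    using fin M(1) by (simp add: sum.remove)
  ultimately show ?case
    using Suc.hyps(2)[symmetric] by simp
qed

lemma sum_final_segment_le:
  fixes g :: "nat \<Rightarrow> real"
  assumes "\<And>i j. v < i \<Longrightarrow> i \<le> j \<Longrightarrow> j < N \<Longrightarrow> g j \<le> g i" and "Q \<subseteq> {v<..<N}"
  shows "(\<Sum>b\<in>{N - card Q..<N}. g b) \<le> sum g Q"
proof -
  let ?r = "\<lambda>b. N - Suc b"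
  have inj: "inj_on ?r Q"
  proof (rule inj_onI)
    fix x y assume "x \<in> Q" "y \<in> Q" "?r x = ?r y"
    moreover from this have "x < N" "y < N" using assms(2) by auto
    ultimately show "x = y" by linarith
  qed
  have cQ: "card Q \<le> N"
    using card_mono[OF _ assms(2)] by auto
  have "(\<Sum>c<card (?r ` Q). g (?r c)) \<le> sum (\<lambda>c. g (?r c)) (?r ` Q)"
  proof (rule sum_initial_segment_le[where v = "N - Suc v"])
    show "?r ` Q \<subseteq> {..<N - Suc v}" using assms(2) by fastforce
    show "g (?r i) \<le> g (?r j)" if "i \<le> j" "j < N - Suc v" for i j
      using that by (intro assms(1)) auto
  qed
  also have "sum (\<lambda>c. g (?r c)) (?r ` Q) = sum g Q"
    unfolding sum.reindex[OF inj] o_def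
    using assms(2) by (intro sum.cong arg_cong[of _ _ g]) (auto dest!: subsetD)
  also have "(\<Sum>c<card (?r ` Q). g (?r c)) = (\<Sum>b\<in>{N - card Q..<N}. g b)"
    unfolding card_image[OF inj] using cQ
    by (intro sum.reindex_bij_witness[of _ ?r ?r]) auto
  finally show ?thesis .
qed

definition robinson_fun :: "nat \<Rightarrow> (nat \<Rightarrow> nat \<Rightarrow> real) \<Rightarrow> bool" where
  "robinson_fun n a \<longleftrightarrow> (\<forall>i j. i < n \<longrightarrow> j < n \<longrightarrow> a i j = a j i) \<and>
     (\<forall>i j k. i \<le> j \<and> j \<le> k \<and> k < n \<longrightarrow> a i k \<le> a i j \<and> a i k \<le> a j k)"

lemma robinson_fun_sym: "robinson_fun n a \<Longrightarrow> i < n \<Longrightarrow> j < n \<Longrightarrow> a i j = a j i"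
  unfolding robinson_fun_def by blast

lemma robinson_fun_mono:
  assumes "robinson_fun n a" "i \<le> i'" "i' \<le> j'" "j' \<le> j" "j < n"
  shows "a i j \<le> a i' j'"
proof -
  have "a i j \<le> a i' j"
    using assms unfolding robinson_fun_def by (meson order_trans)
  also have "\<dots> \<le> a i' j'"
    using assms unfolding robinson_fun_def by (meson order_trans)
  finally show ?thesis .
qed

lemma robinson_fun_skip:
  assumes "robinson_fun (Suc n) a"
  shows "robinson_fun n (\<lambda>i j. a (skip v i) (skip v j))"
proof -
  have bound: "skip v i < Suc n" if "i < n" for i
    using that by (simp add: skip_def)
  have mono: "skip v i \<le> skip v j" if "i \<le> j" for i j
    using that by (simp add: skip_def)
  show ?thesis
    unfolding robinson_fun_def
    by (intro conjI allI impI)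
      (auto intro!: robinson_fun_sym[OF assms] robinson_fun_mono[OF assms] mono bound)
qed

text \<open>
  Among the indices of \<open>U\<close>, let \<open>p\<close> lie below \<open>v\<close>. Replacing these by \<open>0, \<dots>, p - 1\<close> and
  the others by \<open>p + m, \<dots>, N - 1\<close> only moves them away from \<open>v\<close>. A lost
  entry with \<open>c < p\<close> is compared with \<open>(c, v)\<close>, one with \<open>c \<ge> p\<close> with \<open>(v, c + m)\<close>.
  Since \<open>p \<le> v\<close>, and since the indices from \<open>p + m\<close> on all exceed \<open>v\<close>, the span of the lost
  entry always contains the interval that it is compared with.
\<close>

lemma deleted_entries_le:
  assumes rob: "robinson_fun N a" and m: "m \<le> N" and v: "v < N"
    and U: "U \<subseteq> {..<N} - {v}" and card_U: "card U = N - m"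
  shows "(\<Sum>c<N - m. deleted_entry m a v c) \<le> (\<Sum>u\<in>U. a u v)"
proof -
  define P where "P = U \<inter> {..<v}"
  define Q where "Q = U \<inter> {v<..<N}"
  define p where "p = card P"
  have fin: "finite U" using U by (meson finite_Diff finite_lessThan finite_subset)
  have UPQ: "U = P \<union> Q" "P \<inter> Q = {}" "finite P" "finite Q"
    using U fin by (auto simp: P_def Q_def)
  have card_PQ: "p + card Q = N - m"
    using UPQ card_U by (simp add: card_Un_disjoint p_def)
  have p_le: "p \<le> v"
    using card_mono[of "{..<v}" P] by (simp add: P_def p_def)
  have "card Q \<le> N - Suc v"
    using card_mono[of "{v<..<N}" Q] by (simp add: Q_def)
  then have v_less: "v < p + m"
    using card_PQ m v by linarith
  have left: "(\<Sum>c<p. a c v) \<le> (\<Sum>u\<in>P. a u v)"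
    unfolding p_def
    by (rule sum_initial_segment_le[where v = v])
      (use v in \<open>auto simp: P_def intro!: robinson_fun_mono[OF rob]\<close>)
  have "(\<Sum>b\<in>{N - card Q..<N}. a v b) \<le> (\<Sum>u\<in>Q. a v u)"
    by (rule sum_final_segment_le[where v = v])
      (use v in \<open>auto simp: Q_def intro!: robinson_fun_mono[OF rob]\<close>)
  also have "(\<Sum>u\<in>Q. a v u) = (\<Sum>u\<in>Q. a u v)"
    using v by (intro sum.cong refl robinson_fun_sym[OF rob]) (auto simp: Q_def)
  also have "(\<Sum>b\<in>{N - card Q..<N}. a v b) = (\<Sum>c\<in>{p..<N - m}. a v (c + m))"
    using card_PQ m
    by (intro sum.reindex_bij_witness[of _ "\<lambda>c. c + m" "\<lambda>b. b - m"]) auto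
  finally have right: "(\<Sum>c\<in>{p..<N - m}. a v (c + m)) \<le> (\<Sum>u\<in>Q. a u v)" .
  have "(\<Sum>c<N - m. deleted_entry m a v c)
      = (\<Sum>c<p. deleted_entry m a v c) + (\<Sum>c\<in>{p..<N - m}. deleted_entry m a v c)"
    using card_PQ by (simp add: lessThan_atLeast0 sum.atLeastLessThan_concat)
  also have "\<dots> \<le> (\<Sum>c<p. a c v) + (\<Sum>c\<in>{p..<N - m}. a v (c + m))"
  proof (intro add_mono sum_mono)
    show "deleted_entry m a v c \<le> a c v" if "c \<in> {..<p}" for c
      unfolding deleted_entry_def using that p_le card_PQ v
      by (intro robinson_fun_mono[OF rob]) auto
    show "deleted_entry m a v c \<le> a v (c + m)" if "c \<in> {p..<N - m}" for c
      unfolding deleted_entry_def using that v_less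
      by (intro robinson_fun_mono[OF rob]) auto
  qed
  also have "\<dots> \<le> (\<Sum>u\<in>P. a u v) + (\<Sum>u\<in>Q. a u v)"
    using left right by linarith
  also have "\<dots> = (\<Sum>u\<in>U. a u v)"
    using UPQ by (simp add: sum.union_disjoint)
  finally show ?thesis .
qed

section \<open>The identity minimizes the corner sum\<close>

lemma corner_sum_permuted_ge:
  assumes "m \<ge> 1" and "robinson_fun n a" and "inj_on \<pi> {..<n}" and "\<pi> ` {..<n} \<subseteq> {..<n}"
  shows "corner_sum m n a \<le> corner_sum m n (\<lambda>i j. a (\<pi> i) (\<pi> j))"
  using assms(2-)
proof (induction n arbitrary: a \<pi>)
  case 0
  then show ?case by (simp add: corner_sum_def)
next
  case (Suc n)
  define v where "v = \<pi> n"
  define a' where "a' = (\<lambda>i j. a (skip v i) (skip v j))"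
  \<comment> \<open>The permutation that \<open>\<pi>\<close> induces after deleting position \<open>n\<close> and index \<open>v\<close>.\<close>
  define \<pi>' where "\<pi>' = (\<lambda>i. if \<pi> i < v then \<pi> i else \<pi> i - 1)"
  have v_le: "v \<le> n" using Suc.prems(3) by (auto simp: v_def)
  have ne: "\<pi> i \<noteq> v" if "i < n" for i
    using Suc.prems(2) that by (auto simp: v_def inj_on_def)
  have le: "\<pi> i \<le> n" if "i < n" for i
    using Suc.prems(3) that by (simp add: image_subset_iff less_Suc_eq_le)
  have skip_\<pi>': "skip v (\<pi>' i) = \<pi> i" if "i < n" for i
    using ne[OF that] by (auto simp: skip_def \<pi>'_def)
  have inj': "inj_on \<pi>' {..<n}"
  proof (rule inj_onI)
    fix i j assume ij: "i \<in> {..<n}" "j \<in> {..<n}" "\<pi>' i = \<pi>' j"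
    then have "\<pi> i = \<pi> j" using skip_\<pi>' by (metis lessThan_iff)
    then show "i = j" using Suc.prems(2) ij by (auto simp: inj_on_def)
  qed
  have range': "\<pi>' ` {..<n} \<subseteq> {..<n}"
  proof (intro image_subsetI)
    fix i assume "i \<in> {..<n}"
    then show "\<pi>' i \<in> {..<n}"
      using ne[of i] le[of i] v_le by (auto simp: \<pi>'_def)
  qed
  have "corner_sum m (Suc n) a
      = corner_sum m n a' + (\<Sum>c<Suc n - m. deleted_entry m a v c)"
    unfolding a'_def using assms(1) v_le by (rule corner_sum_delete)
  also have "corner_sum m n a' \<le> corner_sum m n (\<lambda>i j. a' (\<pi>' i) (\<pi>' j))"
    unfolding a'_def
    by (rule Suc.IH[OF robinson_fun_skip[OF Suc.prems(1)] inj' range'])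
  also have "corner_sum m n (\<lambda>i j. a' (\<pi>' i) (\<pi>' j)) = corner_sum m n (\<lambda>i j. a (\<pi> i) (\<pi> j))"
    using assms(1) by (intro corner_sum_cong) (auto simp: a'_def skip_\<pi>')
  also have "(\<Sum>c<Suc n - m. deleted_entry m a v c) \<le> (\<Sum>i<Suc n - m. a (\<pi> i) v)"
  proof (cases "m \<le> Suc n")
    case True
    have sub: "{..<Suc n - m} \<subseteq> {..<n}" using assms(1) by auto
    have inj: "inj_on \<pi> {..<Suc n - m}"
      using Suc.prems(2) by (rule inj_on_subset) auto
    have "(\<Sum>c<Suc n - m. deleted_entry m a v c) \<le> (\<Sum>u\<in>\<pi> ` {..<Suc n - m}. a u v)"
    proof (rule deleted_entries_le[OF Suc.prems(1) True])
      show "v < Suc n" using v_le by simp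
      show "\<pi> ` {..<Suc n - m} \<subseteq> {..<Suc n} - {v}"
      proof (intro image_subsetI)
        fix i assume "i \<in> {..<Suc n - m}"
        then have "i < n" using sub by auto
        then show "\<pi> i \<in> {..<Suc n} - {v}" using ne le by (simp add: less_Suc_eq_le)
      qed
      show "card (\<pi> ` {..<Suc n - m}) = Suc n - m" using card_image[OF inj] by simp
    qed
    then show ?thesis by (simp add: sum.reindex[OF inj])
  qed simp
  finally show ?case
    by (simp add: corner_sum_Suc v_def)
qed

theorem theorem3:
  fixes n \<Delta> :: nat and A :: "real mat" and \<pi> :: "nat \<Rightarrow> nat"
  assumes "robinson_similarity n A"
    and "\<Delta> \<in> {1..n - 1}"
    and "\<pi> permutes {0..<n}"
  shows "mat_inner n (permute_mat n \<pi> A) (corner_mat n \<Delta>) \<ge> mat_inner n A (corner_mat n \<Delta>)"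
proof -
  let ?a = "\<lambda>i j. A $$ (i, j)"
  have \<Delta>: "\<Delta> < n" using assms(2) by auto
  have A: "A \<in> carrier_mat n n" "transpose_mat A = A"
    using assms(1) by (auto simp: robinson_similarity_def)
  have sym: "?a i j = ?a j i" if "i < n" "j < n" for i j
    using A that by (metis carrier_matD index_transpose_mat(1))
  have rob: "robinson_fun n ?a"
    using assms(1) sym by (auto simp: robinson_fun_def robinson_similarity_def)
  have \<pi>: "\<pi> i < n" if "i < n" for i
    using permutes_in_image[OF assms(3), of i] that by simp
  have "mat_inner n A (corner_mat n \<Delta>) = 2 * corner_sum (n - \<Delta>) n ?a"
    using \<Delta> sym by (rule mat_inner_corner_mat)
  also have "\<dots> \<le> 2 * corner_sum (n - \<Delta>) n (\<lambda>i j. ?a (\<pi> i) (\<pi> j))"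
    using corner_sum_permuted_ge[OF _ rob permutes_inj_on[OF assms(3)], of "n - \<Delta>"] \<Delta> \<pi>
    by (simp add: image_subset_iff)
  also have "corner_sum (n - \<Delta>) n (\<lambda>i j. ?a (\<pi> i) (\<pi> j))
      = corner_sum (n - \<Delta>) n (\<lambda>i j. permute_mat n \<pi> A $$ (i, j))"
    using \<Delta> by (intro corner_sum_cong) (auto simp: permute_mat_def)
  also have "2 * \<dots> = mat_inner n (permute_mat n \<pi> A) (corner_mat n \<Delta>)"
    using \<Delta> by (intro mat_inner_corner_mat[symmetric])
      (simp_all add: permute_mat_def \<pi> sym)
  finally show ?thesis .
qed

end
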